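(* Let $n,m\ge 0$ be integers, $\alpha\in\mathbb{C}$ with $\operatorname{Re}(\alpha)>0$, and $\lambda\in\mathbb{C}\setminus\{-1\}$. Then $$\mathcal{E}_{n+m}^{(\alpha)}(\lambda)=\sum_{k=0}^{m}\sum_{j=0}^{n}\binom{n}{j}\genfrac{\{}{\}}{0pt}{}{m}{k}\binom{\alpha+k-1}{k}\frac{(-\lambda)^{k}\,k!\,k^{\,n-j}}{2^{k}}\,\mathcal{E}_{j}^{(\alpha+k)}(\lambda).$$
   Context: $\genfrac{\{}{\}}{0pt}{}{m}{k}$ are the Stirling numbers of the second kind and $\binom{\alpha+k-1}{k}=\frac{\alpha(\alpha+1)\cdots(\alpha+k-1)}{k!}$. Apostol-Euler numbers of order $\alpha$ ($\lambda\ne-1$): $\left(\frac{2}{\lambda e^t+1}\right)^\alpha=\sum_{n\ge0}\mathcal{E}_n^{(\alpha)}(\lambda)\frac{t^n}{n!}$, where, for a logarithm $L$ of $\lambda+1$ fixed once and for all (e.g. the principal one), the power means the power series in $t$ with constant term $2^\alpha e^{-\alpha L}$. Convention: $0^0=1$. *)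

theory Defs
  imports
    "HOL-Analysis.Analysis"
    "HOL-Computational_Algebra.Formal_Power_Series"
    "HOL-Combinatorics.Stirling"
begin

unbundle no vec_syntax
unbundle fps_syntax

text \<open>
  For a power series \<open>F\<close> with nonzero constant term \<open>a = F $ 0\<close>, the power \<open>F ^ \<alpha>\<close> with complex
  exponent is \<open>c (1 + (F / a - 1)) ^ \<alpha>\<close>, expanded by the binomial series, where the prescribed
  constant term \<open>c\<close> is the chosen value of \<open>a ^ \<alpha>\<close>.
\<close>

definition fps_cpower :: "complex \<Rightarrow> complex fps \<Rightarrow> complex \<Rightarrow> complex fps" where
  "fps_cpower c F \<alpha> =
     fps_const c * (fps_binomial \<alpha> oo (fps_const (inverse (F $ 0)) * F - 1))"

lemma fps_cpower_nth_0 [simp]: "fps_cpower c F \<alpha> $ 0 = c"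
  by (simp add: fps_cpower_def)

lemma fps_cpower_of_nat:
  assumes "F $ 0 \<noteq> 0"
  shows "fps_cpower ((F $ 0) ^ n) F (of_nat n) = F ^ n"
proof -
  let ?G = "fps_const (inverse (F $ 0)) * F - 1"
  have G0: "?G $ 0 = 0" using assms by simp
  have "fps_binomial (of_nat n) oo ?G = ((1 + fps_X) oo ?G) ^ n"
    by (simp only: fps_binomial_of_nat fps_compose_power[OF G0])
  also have "(1 + fps_X) oo ?G = fps_const (inverse (F $ 0)) * F"
    using G0 by (simp add: fps_compose_add_distrib)
  finally show ?thesis
    using assms by (simp add: fps_cpower_def power_mult_distrib field_simps)
qed

lemma fps_cpower_add:
  assumes "F $ 0 \<noteq> 0"
  shows "fps_cpower (c * d) F (\<alpha> + \<beta>) = fps_cpower c F \<alpha> * fps_cpower d F \<beta>"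
proof -
  let ?G = "fps_const (inverse (F $ 0)) * F - 1"
  have G0: "?G $ 0 = 0" using assms by simp
  show ?thesis
    unfolding fps_cpower_def fps_binomial_add_mult fps_compose_mult_distrib[OF G0]
    by (simp only: mult_ac flip: fps_const_mult)
qed

text \<open>
  Here \<open>L\<close> is the chosen logarithm of \<open>lam + 1\<close>, that is, \<open>exp L = lam + 1\<close>.
\<close>

definition apostol_euler_fps :: "complex \<Rightarrow> complex \<Rightarrow> complex \<Rightarrow> complex fps" where
  "apostol_euler_fps L \<alpha> lam =
     fps_cpower (2 powr \<alpha> * exp (- (\<alpha> * L))) (2 / (fps_const lam * fps_exp 1 + 1)) \<alpha>"

lemma apostol_euler_fps_of_nat:
  assumes "exp L = lam + 1"
  shows "apostol_euler_fps L (of_nat k) lam = (2 / (fps_const lam * fps_exp 1 + 1)) ^ k"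
proof -
  let ?F = "2 / (fps_const lam * fps_exp 1 + 1) :: complex fps"
  have nz: "lam + 1 \<noteq> 0"
    using assms exp_not_eq_zero[of L] by simp
  have F0: "?F $ 0 = 2 / (lam + 1)"
    using nz by (simp add: fps_divide_unit divide_inverse)
  have "2 powr of_nat k * exp (- (of_nat k * L)) = (?F $ 0) ^ k"
    by (simp add: F0 powr_nat' exp_minus exp_of_nat_mult assms power_divide divide_inverse
        power_inverse)
  then show ?thesis
    using nz fps_cpower_of_nat[of ?F k] by (simp add: apostol_euler_fps_def F0)
qed

definition apostol_euler :: "complex \<Rightarrow> complex \<Rightarrow> complex \<Rightarrow> nat \<Rightarrow> complex" where
  "apostol_euler L \<alpha> lam n = fact n * apostol_euler_fps L \<alpha> lam $ n"

end

theory Submission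
  imports Defs
begin

text \<open>
  Write \<open>E \<alpha>\<close> for the generating series of order \<open>\<alpha>\<close>. Since
  \<open>F = 2 / (lam * exp t + 1)\<close> satisfies \<open>F' = - (lam / 2) * exp t * F\<^sup>2\<close>, one has
  \<open>(E \<alpha>)' = - (lam / 2) * \<alpha> * exp t * E (\<alpha> + 1)\<close>. Hence the series
  \<open>T k = \<alpha> (\<alpha> + 1) \<cdots> (\<alpha> + k - 1) * (- lam / 2) ^ k * exp (k t) * E (\<alpha> + k)\<close> satisfy
  \<open>(T k)' = k T k + T (k + 1)\<close>, so the Stirling recurrence expands the \<open>m\<close>-th derivative of
  \<open>E \<alpha> = T 0\<close> in the \<open>T k\<close>; comparing coefficients of \<open>t ^ n\<close> gives the theorem.
\<close>

text \<open>The binomial series solves \<open>B' * (1 + X) = \<alpha> * B\<close>; substituting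
  \<open>F / F $ 0 - 1\<close> for \<open>X\<close> and applying the chain rule gives the
  logarithmic derivative. Multiplying through by \<open>F\<close> keeps the statement free of
  division, and the constant term \<open>c\<close> is only a scalar.\<close>

lemma fps_deriv_cpower:
  assumes "F $ 0 \<noteq> 0"
  shows "fps_deriv (fps_cpower c F \<alpha>) * F = fps_const \<alpha> * fps_cpower c F \<alpha> * fps_deriv F"
proof -
  let ?a = "F $ 0"
  let ?G = "fps_const (inverse ?a) * F - 1"
  let ?B = "fps_binomial \<alpha>"
  have G0: "?G $ 0 = 0" using assms by simp
  have "fps_deriv ?B * (1 + fps_X) = fps_const \<alpha> * ?B"
    by (simp add: fps_binomial_deriv fps_divide_unit mult.assoc inverse_mult_eq_1)
  then have "(fps_deriv ?B * (1 + fps_X)) oo ?G = (fps_const \<alpha> * ?B) oo ?G"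
    by simp
  then have ode: "(fps_deriv ?B oo ?G) * (fps_const (inverse ?a) * F) = fps_const \<alpha> * (?B oo ?G)"
    using G0 by (simp add: fps_compose_mult_distrib fps_compose_add_distrib)
  have "fps_deriv (?B oo ?G) = (fps_deriv ?B oo ?G) * (fps_const (inverse ?a) * fps_deriv F)"
    using fps_compose_deriv[OF G0, of ?B] by simp
  then have "fps_deriv (fps_cpower c F \<alpha>) * F
      = fps_const c * ((fps_deriv ?B oo ?G) * (fps_const (inverse ?a) * F)) * fps_deriv F"
    by (simp only: fps_cpower_def fps_deriv_mult_const_left mult_ac)
  also have "\<dots> = fps_const \<alpha> * fps_cpower c F \<alpha> * fps_deriv F"
    unfolding ode by (simp only: fps_cpower_def mult_ac)
  finally show ?thesis .
qed

text \<open>The prescribed constant terms multiply as the exponents add, so the exponent law splits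
  off the series of order 1. That series is the base itself because \<open>L\<close> is a logarithm
  of \<open>lam + 1\<close>.\<close>

lemma apostol_euler_fps_plus_1:
  assumes "exp L = lam + 1"
  shows "apostol_euler_fps L (\<alpha> + 1) lam
    = apostol_euler_fps L \<alpha> lam * (2 / (fps_const lam * fps_exp 1 + 1))"
proof -
  let ?F = "2 / (fps_const lam * fps_exp 1 + 1) :: complex fps"
  have nz: "lam + 1 \<noteq> 0"
    using assms exp_not_eq_zero[of L] by simp
  then have F0: "?F $ 0 \<noteq> 0"
    by (simp add: fps_divide_unit)
  have "(2::complex) powr (\<alpha> + 1) * exp (- ((\<alpha> + 1) * L))
      = (2 powr \<alpha> * exp (- (\<alpha> * L))) * (2 powr 1 * exp (- (1 * L)))"
    by (simp add: powr_add distrib_right exp_diff exp_minus divide_inverse)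
  then have "apostol_euler_fps L (\<alpha> + 1) lam
      = apostol_euler_fps L \<alpha> lam * apostol_euler_fps L 1 lam"
    using fps_cpower_add[OF F0] by (simp add: apostol_euler_fps_def)
  also have "apostol_euler_fps L 1 lam = ?F"
    using apostol_euler_fps_of_nat[OF assms, of 1] by simp
  finally show ?thesis .
qed

lemma fps_deriv_apostol_euler_fps:
  assumes "exp L = lam + 1"
  shows "fps_deriv (apostol_euler_fps L \<alpha> lam)
    = fps_const (\<alpha> * (- lam / 2)) * fps_exp 1 * apostol_euler_fps L (\<alpha> + 1) lam"
proof -
  let ?P = "fps_const lam * fps_exp 1 + 1 :: complex fps"
  let ?F = "2 / ?P"
  let ?E = "apostol_euler_fps L \<alpha> lam"
  have nz: "lam + 1 \<noteq> 0"
    using assms exp_not_eq_zero[of L] by simp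
  have F0: "?F $ 0 \<noteq> 0"
    using nz by (simp add: fps_divide_unit)
  then have F_nz: "?F \<noteq> 0"
    by (metis fps_zero_nth)
  have P_nz: "?P \<noteq> 0"
    using F_nz by force
  have FP: "?F * ?P = 2"
    using nz by (simp add: fps_divide_unit mult.assoc inverse_mult_eq_1)
  \<comment> \<open>Differentiating \<open>?F * ?P = 2\<close> replaces the quotient rule.\<close>
  have "fps_deriv ?F * ?P + ?F * (fps_const lam * fps_exp 1) = fps_deriv (?F * ?P)"
    by (simp add: mult_ac)
  also have "\<dots> = 0"
    unfolding FP by simp
  finally have "fps_deriv ?F * ?P = - (fps_const lam * fps_exp 1) * ?F"
    by (simp add: eq_neg_iff_add_eq_0 mult_ac)
  \<comment> \<open>A factor 2 is split off to be rewritten as \<open>?F * ?P\<close>; this yields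
    the second \<open>?F\<close> and a \<open>?P\<close> to cancel.\<close>
  also have "\<dots> = fps_const (- lam / 2) * fps_exp 1 * ?F * 2"
    by (simp add: numeral_fps_const mult_ac flip: fps_const_neg)
  also have "\<dots> = (fps_const (- lam / 2) * fps_exp 1 * ?F * ?F) * ?P"
    by (simp only: FP mult.assoc)
  finally have dF: "fps_deriv ?F = fps_const (- lam / 2) * fps_exp 1 * ?F * ?F"
    using P_nz by (simp only: mult_cancel_right) simp
  have "fps_deriv ?E * ?F = fps_const \<alpha> * ?E * fps_deriv ?F"
    unfolding apostol_euler_fps_def by (rule fps_deriv_cpower[OF F0])
  also have "\<dots> = (fps_const (\<alpha> * (- lam / 2)) * fps_exp 1 * (?E * ?F)) * ?F"
    unfolding dF by (simp only: mult_ac flip: fps_const_mult)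
  finally show ?thesis
    using F_nz unfolding apostol_euler_fps_plus_1[OF assms] by (simp only: mult_cancel_right) simp
qed

lemma funpow_deriv_Stirling:
  fixes T :: "nat \<Rightarrow> 'a::comm_ring_1 fps"
  assumes "\<And>k. fps_deriv (T k) = of_nat k * T k + T (Suc k)"
  shows "(fps_deriv ^^ m) (T 0) = (\<Sum>k\<le>m. of_nat (Stirling m k) * T k)"
proof (induction m)
  case 0
  then show ?case by simp
next
  case (Suc m)
  have "(\<Sum>k\<le>Suc m. of_nat (Stirling (Suc m) k) * T k)
      = (\<Sum>k\<le>m. of_nat (Stirling m (Suc k)) * (of_nat (Suc k) * T (Suc k)))
        + (\<Sum>k\<le>m. of_nat (Stirling m k) * T (Suc k))"
    by (simp add: sum.atMost_Suc_shift algebra_simps sum.distrib del: sum.atMost_Suc)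
  \<comment> \<open>After the shift, the new term at \<open>k = 0\<close> vanishes through its
    factor \<open>k\<close>; the top term then vanishes since
    \<open>Stirling m (Suc m) = 0\<close>.\<close>
  also have "(\<Sum>k\<le>m. of_nat (Stirling m (Suc k)) * (of_nat (Suc k) * T (Suc k)))
      = (\<Sum>k\<le>Suc m. of_nat (Stirling m k) * (of_nat k * T k))"
    by (simp add: sum.atMost_Suc_shift del: sum.atMost_Suc)
  also have "\<dots> = (\<Sum>k\<le>m. of_nat (Stirling m k) * (of_nat k * T k))"
    by simp
  finally show ?case
    by (simp add: Suc.IH fps_deriv_sum assms distrib_left sum.distrib del: sum.atMost_Suc)
qed

text \<open>The factor \<open>fact n\<close> passes to exponential coefficients, on which
  differentiation is an index shift.\<close>

lemma fact_mult_nth_funpow_deriv: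
  fixes f :: "'a::{comm_ring_1,semiring_char_0} fps"
  shows "fact n * ((fps_deriv ^^ m) f $ n) = fact (n + m) * f $ (n + m)"
proof (induction m arbitrary: f)
  case (Suc m)
  show ?case
    using Suc[of "fps_deriv f"] by (simp add: funpow_swap1 mult_ac)
qed simp

theorem corollary10:
  fixes n m :: nat and \<alpha> lam L :: complex
  assumes "Re \<alpha> > 0"
    and "lam \<noteq> - 1"
    and "exp L = lam + 1"
  shows "apostol_euler L \<alpha> lam (n + m) =
    (\<Sum>k = 0..m. \<Sum>j = 0..n.
       of_nat (n choose j) * of_nat (Stirling m k) * ((\<alpha> + of_nat k - 1) gchoose k)
       * ((- lam) ^ k * fact k * of_nat k ^ (n - j) / 2 ^ k)
       * apostol_euler L (\<alpha> + of_nat k) lam j)"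
proof -
  define c where "c k = pochhammer \<alpha> k * (- lam / 2) ^ k" for k
  define E where "E k = apostol_euler_fps L (\<alpha> + of_nat k) lam" for k
  define T where "T k = fps_const (c k) * (E k * fps_exp (of_nat k))" for k
  have dE: "fps_deriv (E k)
      = fps_const ((\<alpha> + of_nat k) * (- lam / 2)) * fps_exp 1 * E (Suc k)" for k
    using fps_deriv_apostol_euler_fps[OF assms(3), of "\<alpha> + of_nat k"]
    by (simp add: E_def add_ac)
  have c_Suc: "c (Suc k) = c k * ((\<alpha> + of_nat k) * (- lam / 2))" for k
    by (simp add: c_def pochhammer_Suc)
  have "fps_deriv (T k) = of_nat k * T k + T (Suc k)" for k
  proof -
    \<comment> \<open>The factor \<open>fps_exp 1\<close> in \<open>dE\<close> raises the
      exponential to \<open>k + 1\<close>. Thus \<open>T (Suc k)\<close> is the part of the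
      derivative that falls on \<open>E k\<close>, and \<open>k * T k\<close> the part that falls on
      the exponential.\<close>
    have "fps_exp (of_nat (Suc k) :: complex) = fps_exp 1 * fps_exp (of_nat k)"
      by (simp add: fps_exp_add_mult)
    then have "T (Suc k) = fps_const (c k) * (fps_deriv (E k) * fps_exp (of_nat k))"
      unfolding T_def dE c_Suc by (simp only: mult_ac flip: fps_const_mult)
    then show ?thesis
      by (simp add: T_def algebra_simps flip: fps_of_nat)
  qed
  then have expand: "(fps_deriv ^^ m) (T 0) = (\<Sum>k\<le>m. of_nat (Stirling m k) * T k)"
    by (rule funpow_deriv_Stirling)
  have T_nth: "fact n * (T k $ n) = (\<Sum>j\<le>n. of_nat (n choose j)
      * (c k * of_nat k ^ (n - j)) * apostol_euler L (\<alpha> + of_nat k) lam j)" for k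
  proof -
    \<comment> \<open>Cauchy product; for \<open>k = 0\<close> the convention
      \<open>0 ^ 0 = 1\<close> leaves only \<open>j = n\<close>.\<close>
    have "T k $ n = c k * (\<Sum>j\<le>n. E k $ j * (of_nat k ^ (n - j) / fact (n - j)))"
      by (simp add: T_def fps_mult_nth[of "E k"] atLeast0AtMost)
    then have "fact n * (T k $ n)
        = (\<Sum>j\<le>n. fact n * (c k * (E k $ j * (of_nat k ^ (n - j) / fact (n - j)))))"
      by (simp only: sum_distrib_left)
    also have "\<dots> = (\<Sum>j\<le>n. of_nat (n choose j)
        * (c k * of_nat k ^ (n - j)) * apostol_euler L (\<alpha> + of_nat k) lam j)"
      by (intro sum.cong refl) (simp add: binomial_fact apostol_euler_def E_def)
    finally show ?thesis .
  qed
  \<comment> \<open>The rising factorial in \<open>c k\<close> is \<open>fact k\<close> times the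
    generalized binomial coefficient.\<close>
  have c_eq: "c k = ((\<alpha> + of_nat k - 1) gchoose k) * ((- lam) ^ k * fact k / 2 ^ k)" for k
    by (simp add: c_def gbinomial_pochhammer' power_divide del: divide_minus_left)
  \<comment> \<open>\<open>T 0\<close> is the generating series of order \<alpha>, since
    \<open>c 0 = 1\<close> and \<open>fps_exp 0 = 1\<close>.\<close>
  have "apostol_euler L \<alpha> lam (n + m) = fact n * ((fps_deriv ^^ m) (T 0) $ n)"
    by (simp add: fact_mult_nth_funpow_deriv apostol_euler_def T_def E_def c_def)
  also have "\<dots> = (\<Sum>k\<le>m. of_nat (Stirling m k) * (fact n * (T k $ n)))"
    by (simp add: expand fps_sum_nth sum_distrib_left mult_ac flip: fps_of_nat)
  also have "\<dots> = (\<Sum>k = 0..m. \<Sum>j = 0..n.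
       of_nat (n choose j) * of_nat (Stirling m k) * ((\<alpha> + of_nat k - 1) gchoose k)
       * ((- lam) ^ k * fact k * of_nat k ^ (n - j) / 2 ^ k)
       * apostol_euler L (\<alpha> + of_nat k) lam j)"
    unfolding T_nth c_eq atLeast0AtMost sum_distrib_left by (intro sum.cong refl) simp
  finally show ?thesis .
qed

end
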